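(* Let $r=(r_n)$, $t=(t_n)$ be scalar sequences with $r_n\neq 0$ and $t_n\neq 0$ for all $n\in\mathbb{N}_0$, let $s=(s_n)$ be a scalar sequence with $s_0\neq 0$, and let $A=(a_{nk})_{n,k\in\mathbb{N}_0}$ be an infinite scalar matrix with rows $A_n=(a_{nk})_k$. Put $$R_k(A_n)=r_k\bigg[\frac{a_{nk}}{s_0t_k}+\Big(\frac{D_0^{(s)}}{t_k}-\frac{D_1^{(s)}}{t_{k+1}}\Big)\sum_{j=k+1}^{\infty}a_{nj}+\sum_{l=2}^{\infty}(-1)^l\frac{D_l^{(s)}}{t_{l+k}}\sum_{j=k+l}^{\infty}a_{nj}\bigg]$$ and, for $0\le k\le m$, $$w^{A_n}_{mk}=r_k\bigg[\sum_{l=0}^{m-k}(-1)^l\frac{D_l^{(s)}}{t_{l+k}}\sum_{j=m}^{\infty}a_{nj}+\sum_{l=m-k+1}^{\infty}(-1)^l\frac{D_l^{(s)}}{t_{l+k}}\sum_{j=k+l}^{\infty}a_{nj}\bigg],$$ with $w^{A_n}_{mk}=0$ for $k>m$. Consider the conditions: (C1) $\sup_n\sum_{k=0}^{\infty}|R_k(A_n)|<\infty$; (C2) $\lim_{n\to\infty}R_k(A_n)$ exists for all $k$; (C3) $\lim_{n\to\infty}\sum_{k=0}^{\infty}|R_k(A_n)|=0$; (C4) $\lim_{m\to\infty}\sum_{k=0}^{m}|w^{A_n}_{mk}|=0$ for all $n$; (C5) $\lim_{n\to\infty}\sum_{k=0}^{\infty}\big|R_k(A_n)-\lim_{n'\to\infty}R_k(A_{n'})\big|=0$.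 Then: (a) $A\in(l_\infty(r,s,t;\Delta),c_0)$ if and only if (C3) and (C4) hold. (b) $A\in(l_\infty(r,s,t;\Delta),c)$ if and only if (C1), (C2), (C4) and (C5) hold. (c) $A\in(l_\infty(r,s,t;\Delta),l_\infty)$ if and only if (C1) and (C4) hold.
   Context: $\mathbb{N}_0=\{0,1,2,\dots\}$; $w$ is the space of all real or complex sequences $x=(x_n)_{n\in\mathbb{N}_0}$. $l_\infty$, $c$, $c_0$ are the spaces of bounded, convergent and null sequences. $\Delta x_k=x_k-x_{k-1}$ with $x_{-1}=0$, and $$l_\infty(r,s,t;\Delta)=\Big\{x\in w:\Big(\frac{1}{r_n}\sum_{k=0}^{n}s_{n-k}t_k\Delta x_k\Big)_{n}\in l_\infty\Big\}.$$ The numbers $D_n^{(s)}$ are: $D_0^{(s)}=1/s_0$, and for $n\ge1$, $D_n^{(s)}=s_0^{-(n+1)}\det M_n$, where $M_n$ is the $n\times n$ matrix whose $(i,j)$ entry ($1\le i,j\le n$) is $s_{i-j+1}$ if $i-j+1\ge 0$ and $0$ otherwise. For sequence spaces $U,V$, $A\in(U,V)$ means that for every $x\in U$ the series $(Ax)_n=\sum_{k=0}^{\infty}a_{nk}x_k$ converges for every $n$ and $Ax=((Ax)_n)_n\in V$.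
   Formalization: The series in R_k and w_mk are read as limits, N→∞, of the same expressions with every sum over j stopped at N, not as iterated series; the latter need not exist for A in the class (s=t=1, r_k=2^-k, row 0 all ones, other rows 0), so "only if" fails for them. *)

theory Defs
  imports "HOL-Analysis.Analysis" "Jordan_Normal_Form.Determinant"
begin

text \<open>
  Scalars are elements of a type of class \<open>{real_normed_field, banach}\<close>, of which the real and
  the complex numbers are the instances.
\<close>

definition linf :: "(nat \<Rightarrow> 'a::real_normed_field) set"
  where "linf = {x. Bseq x}"

definition cs :: "(nat \<Rightarrow> 'a::real_normed_field) set"
  where "cs = {x. convergent x}"

definition c0 :: "(nat \<Rightarrow> 'a::real_normed_field) set"
  where "c0 = {x. x \<longlonglongrightarrow> 0}"

definition bdiff :: "(nat \<Rightarrow> 'a::real_normed_field) \<Rightarrow> nat \<Rightarrow> 'a"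
  where "bdiff x k = x k - (if k = 0 then 0 else x (k - 1))"

definition linf_diff ::
    "(nat \<Rightarrow> 'a::real_normed_field) \<Rightarrow> (nat \<Rightarrow> 'a) \<Rightarrow> (nat \<Rightarrow> 'a) \<Rightarrow> (nat \<Rightarrow> 'a) set"
  where "linf_diff r s t =
    {x. (\<lambda>n. 1 / r n * (\<Sum>k=0..n. s (n - k) * t k * bdiff x k)) \<in> linf}"

definition matrix_class ::
    "(nat \<Rightarrow> 'a::real_normed_field) set \<Rightarrow> (nat \<Rightarrow> 'a) set \<Rightarrow> (nat \<Rightarrow> nat \<Rightarrow> 'a) set"
  where "matrix_class U V =
    {A. \<forall>x\<in>U. (\<forall>n. summable (\<lambda>k. A n k * x k)) \<and> (\<lambda>n. \<Sum>k. A n k * x k) \<in> V}"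

text \<open>Matrix indices of \<^const>\<open>mat\<close> start at 0, which does not affect \<open>i - j + 1\<close>.\<close>

definition D :: "(nat \<Rightarrow> 'a::real_normed_field) \<Rightarrow> nat \<Rightarrow> 'a"
  where "D s n = (if n = 0 then 1 / s 0
    else Determinant.det (mat n n (\<lambda>(i, j). if j \<le> i + 1 then s (i + 1 - j) else 0)) / s 0 ^ (n + 1))"

definition sum_from :: "nat \<Rightarrow> (nat \<Rightarrow> 'a::real_normed_field) \<Rightarrow> 'a"
  where "sum_from m f = (\<Sum>j. f (m + j))"

text \<open>The displayed expressions, with iterated series; meaningful if all these series converge.\<close>

definition R_formula ::
    "(nat \<Rightarrow> 'a::real_normed_field) \<Rightarrow> (nat \<Rightarrow> 'a) \<Rightarrow> (nat \<Rightarrow> 'a) \<Rightarrow> (nat \<Rightarrow> 'a) \<Rightarrow> nat \<Rightarrow> 'a"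
  where "R_formula r s t a k =
    r k * (a k / (s 0 * t k)
      + (D s 0 / t k - D s 1 / t (k + 1)) * sum_from (k + 1) a
      + sum_from 2 (\<lambda>l. (-1) ^ l * (D s l / t (l + k)) * sum_from (k + l) a))"

definition w_formula ::
    "(nat \<Rightarrow> 'a::real_normed_field) \<Rightarrow> (nat \<Rightarrow> 'a) \<Rightarrow> (nat \<Rightarrow> 'a) \<Rightarrow> (nat \<Rightarrow> 'a) \<Rightarrow> nat \<Rightarrow> nat \<Rightarrow> 'a"
  where "w_formula r s t a m k =
    (if k \<le> m then
       r k * ((\<Sum>l=0..m - k. (-1) ^ l * (D s l / t (l + k)) * sum_from m a)
         + sum_from (m - k + 1) (\<lambda>l. (-1) ^ l * (D s l / t (l + k)) * sum_from (k + l) a))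
     else 0)"

text \<open>
  For an arbitrary row the infinite series are understood jointly, as the limit for
  \<open>N \<rightarrow> \<infinity>\<close> of the same expression with every summation over \<open>j\<close> ending at \<open>N\<close> (all series are
  then finite sums).  This is how the expressions arise from \<open>\<Sum>k\<le>N. a k * x k\<close>.  They cannot be
  read as iterated series throughout: for \<open>s = t = (1,1,1,...)\<close> and \<open>r k = 1 / 2 ^ k\<close> the space
  \<open>linf_diff r s t\<close> is the set of all \<open>x\<close> with \<open>x k = O(1 / 2 ^ k)\<close>, and the matrix with first row
  \<open>(1,1,1,...)\<close> and all other rows 0 maps it into \<open>c0\<close>, although the series
  \<open>\<Sum>j. A 0 j\<close> diverges, so that the iterated series do not exist for this row.  Lemma \<open>cut_limit_eq_formula\<close> below compares the two readings.
\<close>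

definition cut :: "nat \<Rightarrow> (nat \<Rightarrow> 'a::real_normed_field) \<Rightarrow> nat \<Rightarrow> 'a"
  where "cut N a j = (if j \<le> N then a j else 0)"

definition R ::
    "(nat \<Rightarrow> 'a::real_normed_field) \<Rightarrow> (nat \<Rightarrow> 'a) \<Rightarrow> (nat \<Rightarrow> 'a) \<Rightarrow> (nat \<Rightarrow> 'a) \<Rightarrow> nat \<Rightarrow> 'a"
  where "R r s t a k = lim (\<lambda>N. R_formula r s t (cut N a) k)"

definition w ::
    "(nat \<Rightarrow> 'a::real_normed_field) \<Rightarrow> (nat \<Rightarrow> 'a) \<Rightarrow> (nat \<Rightarrow> 'a) \<Rightarrow> (nat \<Rightarrow> 'a) \<Rightarrow> nat \<Rightarrow> nat \<Rightarrow> 'a"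
  where "w r s t a m k = lim (\<lambda>N. w_formula r s t (cut N a) m k)"

text \<open>
  Each of the conditions includes the existence of the quantities occurring in it; in particular
  \<open>C1\<close>, \<open>C3\<close> and \<open>C5\<close> require the sums over \<open>k\<close> to be finite for every \<open>n\<close>.
\<close>

definition R_exists ::
    "(nat \<Rightarrow> 'a::real_normed_field) \<Rightarrow> (nat \<Rightarrow> 'a) \<Rightarrow> (nat \<Rightarrow> 'a) \<Rightarrow> (nat \<Rightarrow> nat \<Rightarrow> 'a) \<Rightarrow> bool"
  where "R_exists r s t A \<longleftrightarrow> (\<forall>n k. convergent (\<lambda>N. R_formula r s t (cut N (A n)) k))"

definition w_exists ::
    "(nat \<Rightarrow> 'a::real_normed_field) \<Rightarrow> (nat \<Rightarrow> 'a) \<Rightarrow> (nat \<Rightarrow> 'a) \<Rightarrow> (nat \<Rightarrow> nat \<Rightarrow> 'a) \<Rightarrow> bool"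
  where "w_exists r s t A \<longleftrightarrow> (\<forall>n m k. convergent (\<lambda>N. w_formula r s t (cut N (A n)) m k))"

definition C1 ::
    "(nat \<Rightarrow> 'a::real_normed_field) \<Rightarrow> (nat \<Rightarrow> 'a) \<Rightarrow> (nat \<Rightarrow> 'a) \<Rightarrow> (nat \<Rightarrow> nat \<Rightarrow> 'a) \<Rightarrow> bool"
  where "C1 r s t A \<longleftrightarrow> R_exists r s t A
    \<and> (\<forall>n. summable (\<lambda>k. norm (R r s t (A n) k)))
    \<and> bdd_above (range (\<lambda>n. \<Sum>k. norm (R r s t (A n) k)))"

definition C2 ::
    "(nat \<Rightarrow> 'a::real_normed_field) \<Rightarrow> (nat \<Rightarrow> 'a) \<Rightarrow> (nat \<Rightarrow> 'a) \<Rightarrow> (nat \<Rightarrow> nat \<Rightarrow> 'a) \<Rightarrow> bool"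
  where "C2 r s t A \<longleftrightarrow> R_exists r s t A \<and> (\<forall>k. convergent (\<lambda>n. R r s t (A n) k))"

definition C3 ::
    "(nat \<Rightarrow> 'a::real_normed_field) \<Rightarrow> (nat \<Rightarrow> 'a) \<Rightarrow> (nat \<Rightarrow> 'a) \<Rightarrow> (nat \<Rightarrow> nat \<Rightarrow> 'a) \<Rightarrow> bool"
  where "C3 r s t A \<longleftrightarrow> R_exists r s t A
    \<and> (\<forall>n. summable (\<lambda>k. norm (R r s t (A n) k)))
    \<and> (\<lambda>n. \<Sum>k. norm (R r s t (A n) k)) \<longlonglongrightarrow> 0"

definition C4 ::
    "(nat \<Rightarrow> 'a::real_normed_field) \<Rightarrow> (nat \<Rightarrow> 'a) \<Rightarrow> (nat \<Rightarrow> 'a) \<Rightarrow> (nat \<Rightarrow> nat \<Rightarrow> 'a) \<Rightarrow> bool"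
  where "C4 r s t A \<longleftrightarrow> w_exists r s t A
    \<and> (\<forall>n. (\<lambda>m. \<Sum>k=0..m. norm (w r s t (A n) m k)) \<longlonglongrightarrow> 0)"

definition C5 ::
    "(nat \<Rightarrow> 'a::real_normed_field) \<Rightarrow> (nat \<Rightarrow> 'a) \<Rightarrow> (nat \<Rightarrow> 'a) \<Rightarrow> (nat \<Rightarrow> nat \<Rightarrow> 'a) \<Rightarrow> bool"
  where "C5 r s t A \<longleftrightarrow> C2 r s t A
    \<and> (\<forall>n. summable (\<lambda>k. norm (R r s t (A n) k - lim (\<lambda>n'. R r s t (A n') k))))
    \<and> (\<lambda>n. \<Sum>k. norm (R r s t (A n) k - lim (\<lambda>n'. R r s t (A n') k))) \<longlonglongrightarrow> 0"

lemma sum_from_cut: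
  assumes "summable a" "m \<le> N + 1"
  shows "sum_from m (cut N a) = sum_from m a - sum_from (N + 1) a"
proof -
  have "sum_from m (cut N a) = (\<Sum>j<N + 1 - m. a (m + j))"
    unfolding sum_from_def
    by (subst suminf_finite[of "{..<N + 1 - m}"]) (auto simp: cut_def intro!: sum.cong)
  moreover have "sum_from m a = (\<Sum>j. a (m + (j + (N + 1 - m)))) + (\<Sum>j<N + 1 - m. a (m + j))"
    unfolding sum_from_def
    using suminf_split_initial_segment[of "\<lambda>j. a (m + j)" "N + 1 - m"] assms(1)
    by (simp add: summable_iff_shift[of a m] add.commute)
  moreover have "(\<Sum>j. a (m + (j + (N + 1 - m)))) = sum_from (N + 1) a"
    unfolding sum_from_def using assms(2) by (intro suminf_cong arg_cong[where f=a]) linarith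
  ultimately show ?thesis by simp
qed

lemma sum_from_cut_0: "N < m \<Longrightarrow> sum_from m (cut N a) = 0"
  by (simp add: sum_from_def cut_def)

lemma sum_from_split:
  fixes f :: "nat \<Rightarrow> 'a::{real_normed_field, banach}"
  assumes "summable f"
  shows "(\<Sum>l. f l) = (\<Sum>l<m. f l) + sum_from m f"
  using suminf_split_initial_segment[OF assms, of m] by (simp add: sum_from_def add.commute)

lemma sum_from_tendsto_0:
  fixes f :: "nat \<Rightarrow> 'a::{real_normed_field, banach}"
  assumes "summable f"
  shows "(\<lambda>m. sum_from m f) \<longlonglongrightarrow> 0"
proof -
  have "(\<lambda>m. (\<Sum>l. f l) - (\<Sum>l<m. f l)) \<longlonglongrightarrow> (\<Sum>l. f l) - (\<Sum>l. f l)"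
    by (intro tendsto_intros summable_LIMSEQ assms)
  moreover have "(\<Sum>l. f l) - (\<Sum>l<m. f l) = sum_from m f" for m
    using sum_from_split[OF assms, of m] by simp
  ultimately show ?thesis by simp
qed

lemma R_formula_eq:
  fixes a :: "nat \<Rightarrow> 'a::{real_normed_field, banach}"
  assumes "summable a" "summable (\<lambda>l. (-1) ^ l * (D s l / t (l + k)) * sum_from (k + l) a)"
  shows "R_formula r s t a k = r k * (\<Sum>l. (-1) ^ l * (D s l / t (l + k)) * sum_from (k + l) a)"
proof -
  have "sum_from k a = a k + sum_from (k + 1) a"
    unfolding sum_from_def
    using suminf_split_initial_segment[of "\<lambda>j. a (k + j)" 1] assms(1)
    by (simp add: summable_iff_shift[of a k] add.commute)
  then show ?thesis
    unfolding R_formula_def sum_from_split[OF assms(2), of 2]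
    by (simp add: numeral_2_eq_2 D_def[of s 0] algebra_simps add_divide_distrib)
qed

lemma w_formula_eq:
  fixes a :: "nat \<Rightarrow> 'a::{real_normed_field, banach}"
  assumes "summable a" "summable (\<lambda>l. (-1) ^ l * (D s l / t (l + k)) * sum_from (k + l) a)"
    and "k \<le> m"
  shows "w_formula r s t a m k = R_formula r s t a k
    + r k * (\<Sum>l=0..m - k. (-1) ^ l * (D s l / t (l + k)) * (sum_from m a - sum_from (k + l) a))"
proof -
  have *: "{..<m - k + 1} = {0..m - k}" by auto
  show ?thesis
    using assms(3) unfolding R_formula_eq[OF assms(1,2)] w_formula_def
      sum_from_split[OF assms(2), of "m - k + 1"] *
    by (simp add: right_diff_distrib distrib_left sum_subtractf)
qed

text \<open>
  If the iterated series converge and satisfy \<open>C4\<close> (only the columnwise limits are needed), then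
  they agree with the limits in \<^const>\<open>R\<close> and \<^const>\<open>w\<close>.
\<close>

lemma cut_limit_eq_formula:
  fixes a :: "nat \<Rightarrow> 'a::{real_normed_field, banach}"
  assumes a: "summable a"
    and sm: "summable (\<lambda>l. (-1) ^ l * (D s l / t (l + k)) * sum_from (k + l) a)"
    and w0: "(\<lambda>m. w_formula r s t a m k) \<longlonglongrightarrow> 0" and r: "r k \<noteq> 0"
  shows "(\<lambda>N. R_formula r s t (cut N a) k) \<longlonglongrightarrow> R_formula r s t a k"
    and "(\<lambda>N. w_formula r s t (cut N a) m k) \<longlonglongrightarrow> w_formula r s t a m k"
proof -
  define p where "p l = (-1) ^ l * (D s l / t (l + k))" for l
  define \<sigma> where "\<sigma> m = sum_from m a" for m
  have sm': "summable (\<lambda>l. p l * \<sigma> (k + l))" using sm by (simp add: p_def \<sigma>_def)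
  have fin: "summable (cut N a)" "summable (\<lambda>l. p l * sum_from (k + l) (cut N a))" for N
  proof -
    show "summable (cut N a)"
      by (rule summable_finite[of "{..N}"]) (auto simp: cut_def)
    show "summable (\<lambda>l. p l * sum_from (k + l) (cut N a))"
      by (rule summable_finite[of "{..N}"]) (auto simp: sum_from_cut_0)
  qed
  have "(\<lambda>M. w_formula r s t a (M + 1 + k) k / r k - sum_from (M + 2) (\<lambda>l. p l * \<sigma> (k + l))
      - p (M + 1) * \<sigma> (k + (M + 1))) \<longlonglongrightarrow> 0 / r k - 0 - 0"
    using LIMSEQ_ignore_initial_segment[OF w0, of "1 + k"] r
      LIMSEQ_ignore_initial_segment[OF sum_from_tendsto_0[OF sm'], of 2]
      LIMSEQ_ignore_initial_segment[OF summable_LIMSEQ_zero[OF sm'], of 1]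
    by (intro tendsto_intros) (auto simp: add.assoc)
  moreover have "w_formula r s t a (M + 1 + k) k / r k - sum_from (M + 2) (\<lambda>l. p l * \<sigma> (k + l))
      - p (M + 1) * \<sigma> (k + (M + 1)) = (\<Sum>l\<le>M. p l) * \<sigma> (M + k + 1)" for M
  proof -
    have "w_formula r s t a (M + 1 + k) k
        = r k * ((\<Sum>l\<le>M + 1. p l) * \<sigma> (M + 1 + k) + sum_from (M + 2) (\<lambda>l. p l * \<sigma> (k + l)))"
      unfolding w_formula_def p_def \<sigma>_def by (simp add: sum_distrib_right atLeast0AtMost left_diff_distrib)
    then show ?thesis using r by (simp add: distrib_right add.commute)
  qed
  ultimately have E: "(\<lambda>M. (\<Sum>l\<le>M. p l) * \<sigma> (M + k + 1)) \<longlonglongrightarrow> 0" by simp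
  have cutR: "R_formula r s t (cut (M + k) a) k
      = r k * ((\<Sum>l<M + 1. p l * \<sigma> (k + l)) - (\<Sum>l\<le>M. p l) * \<sigma> (M + k + 1))" for M
  proof -
    have "(\<Sum>l. p l * sum_from (k + l) (cut (M + k) a))
        = (\<Sum>l\<le>M. p l * sum_from (k + l) (cut (M + k) a))"
      by (rule suminf_finite) (auto simp: sum_from_cut_0)
    also have "\<dots> = (\<Sum>l\<le>M. p l * (\<sigma> (k + l) - \<sigma> (M + k + 1)))"
      by (intro sum.cong refl) (simp add: sum_from_cut[OF a] \<sigma>_def)
    also have "\<dots> = (\<Sum>l<M + 1. p l * \<sigma> (k + l)) - (\<Sum>l\<le>M. p l) * \<sigma> (M + k + 1)"
      by (simp add: right_diff_distrib sum_subtractf sum_distrib_right lessThan_Suc_atMost)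
    finally show ?thesis using R_formula_eq[OF fin(1), of s t k "M + k" r] fin(2)[of "M + k"]
      by (simp add: p_def)
  qed
  have "(\<lambda>M. r k * ((\<Sum>l<M + 1. p l * \<sigma> (k + l)) - (\<Sum>l\<le>M. p l) * \<sigma> (M + k + 1)))
      \<longlonglongrightarrow> r k * ((\<Sum>l. p l * \<sigma> (k + l)) - 0)"
    by (intro tendsto_intros E LIMSEQ_ignore_initial_segment[OF summable_LIMSEQ[OF sm'], of 1])
  then have "(\<lambda>M. R_formula r s t (cut (M + k) a) k) \<longlonglongrightarrow> R_formula r s t a k"
    unfolding cutR using R_formula_eq[OF a sm, of r] by (simp add: p_def \<sigma>_def)
  then show lim_R: "(\<lambda>N. R_formula r s t (cut N a) k) \<longlonglongrightarrow> R_formula r s t a k"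
    by (rule LIMSEQ_offset)
  have cut_tail: "(\<lambda>N. sum_from m (cut N a)) \<longlonglongrightarrow> sum_from m a" for m
  proof -
    have "(\<lambda>N. sum_from m a - sum_from (N + 1) a) \<longlonglongrightarrow> sum_from m a - 0"
      by (intro tendsto_intros LIMSEQ_ignore_initial_segment[OF sum_from_tendsto_0[OF a], of 1])
    moreover have "\<forall>\<^sub>F N in sequentially. sum_from m a - sum_from (N + 1) a = sum_from m (cut N a)"
      using eventually_ge_at_top[of m] by eventually_elim (simp add: sum_from_cut[OF a])
    ultimately show ?thesis by (simp add: tendsto_cong)
  qed
  show "(\<lambda>N. w_formula r s t (cut N a) m k) \<longlonglongrightarrow> w_formula r s t a m k"
  proof (cases "k \<le> m")
    case True
    have "w_formula r s t (cut N a) m k = R_formula r s t (cut N a) k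
        + r k * (\<Sum>l=0..m - k. p l * (sum_from m (cut N a) - sum_from (k + l) (cut N a)))" for N
      using w_formula_eq[OF fin(1), of s t k N m r] fin(2)[of N] True by (simp add: p_def)
    moreover have "w_formula r s t a m k = R_formula r s t a k
        + r k * (\<Sum>l=0..m - k. p l * (sum_from m a - sum_from (k + l) a))"
      using w_formula_eq[OF a sm True, of r] by (simp add: p_def)
    ultimately show ?thesis
      by (simp only:) (intro tendsto_intros lim_R cut_tail)
  qed (simp add: w_formula_def)
qed

end

theory Submission
  imports Defs
begin

text \<open>
  Write \<open>c l = (-1) ^ l * D s l\<close>.  The determinants \<open>D s l\<close> are exactly such that the power series
  \<open>\<Sum>c l z^l\<close> is the reciprocal of \<open>\<Sum>s l z^l\<close>.  Hence \<open>x \<in> linf_diff r s t\<close> means that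
  \<open>x = T y\<close> for a bounded sequence \<open>y\<close>, where \<open>T\<close> divides the coefficients \<open>r i * y i\<close> by the
  series of \<open>s\<close>, divides by \<open>t\<close> and takes partial sums (\<open>linf_diff_eq_image\<close>).

  For a single row \<open>a\<close>, interchanging finite sums gives \<open>\<Sum>j\<le>N. a j * x j = \<Sum>k\<le>N. Q N k * y k\<close>,
  where \<open>Q N k\<close> is the expression \<open>R_formula\<close> for the row cut off after \<open>N\<close>
  (\<open>partial_sum_eq\<close>).  So the series \<open>\<Sum>a j * x j\<close> converges for all \<open>x\<close> in the space iff the matrix
  \<open>Q\<close> maps bounded sequences to convergent ones.  By Schur's theorem this means that the columns
  of \<open>Q\<close> converge, with limit \<open>R k\<close>, and that \<open>Q N\<close> tends to \<open>R\<close> in \<open>l1\<close>.  For \<open>k \<le> m + 1\<close> the number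
  \<open>w (m + 1) k\<close> is nothing but \<open>R k - Q m k\<close>, and for \<open>k > m\<close> the entry \<open>Q m k\<close> vanishes.  Once \<open>R\<close>
  is in \<open>l1\<close>, the condition \<open>C4\<close> therefore expresses this \<open>l1\<close> convergence (\<open>row_summable_iff\<close>), and
  then \<open>\<Sum>a j * x j = \<Sum>R k * y k\<close> (\<open>row_suminf\<close>).

  Consequently \<open>A\<close> maps the space into \<open>V\<close> iff all rows satisfy these conditions and the matrix of
  the \<open>R k\<close> maps the bounded sequences into \<open>V\<close>.  The classical characterisations of the matrices
  that map \<open>linf\<close> to \<open>c0\<close>, \<open>cs\<close> and \<open>linf\<close> finish the proof.  All of them rest on Schur's gliding
  hump argument (\<open>weakly_null_imp_l1_null\<close>).
\<close>

section \<open>Matrix transformations of the bounded sequences\<close>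

text \<open>
  The conjugate of the sign of \<open>z\<close>, without reference to a conjugation.  As \<open>0 / 0 = 0\<close>, the identity
  \<open>mult_phase\<close> includes \<open>z = 0\<close>.
\<close>
definition phase :: "'a::real_normed_field \<Rightarrow> 'a"
  where "phase z = of_real (norm z) / z"

lemma mult_phase [simp]: "z * phase z = of_real (norm z)"
  by (simp add: phase_def)

lemma norm_phase_le: "norm (phase z) \<le> 1"
  by (simp add: phase_def norm_divide)

lemma in_linfI: "(\<And>k. norm (y k) \<le> C) \<Longrightarrow> y \<in> linf"
  by (auto simp: linf_def intro: BseqI')

lemma in_linfE:
  assumes "y \<in> linf"
  obtains C where "C > 0" "\<And>k. norm (y k) \<le> C"
  using assms by (auto simp: linf_def Bseq_def)

lemma unit_in_linf: "(\<lambda>i. if i = k then 1 else 0) \<in> linf"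
  by (rule in_linfI[of _ 1]) auto

lemma suminf_mult_unit:
  "(\<Sum>i. b i * (if i = k then 1 else 0)) = (b k :: 'a::real_normed_field)"
  by (subst suminf_finite[of "{k}"]) auto

lemma abs_summable_mult_linf:
  fixes b :: "nat \<Rightarrow> 'a::{real_normed_field, banach}"
  assumes "summable (\<lambda>k. norm (b k))" "\<And>k. norm (y k) \<le> C"
  shows "summable (\<lambda>k. b k * y k)" "norm (\<Sum>k. b k * y k) \<le> (\<Sum>k. norm (b k)) * C"
proof -
  have le: "norm (b k * y k) \<le> norm (b k) * C" for k
    using assms(2) by (simp add: norm_mult mult_left_mono)
  have sm: "summable (\<lambda>k. norm (b k) * C)"
    using assms(1) by (rule summable_mult2)
  have sm': "summable (\<lambda>k. norm (b k * y k))"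
    by (rule summable_comparison_test'[OF sm]) (simp add: le)
  then show "summable (\<lambda>k. b k * y k)" by (rule summable_norm_cancel)
  have "norm (\<Sum>k. b k * y k) \<le> (\<Sum>k. norm (b k * y k))"
    by (rule summable_norm[OF sm'])
  also have "\<dots> \<le> (\<Sum>k. norm (b k) * C)" by (rule suminf_le[OF le sm' sm])
  finally show "norm (\<Sum>k. b k * y k) \<le> (\<Sum>k. norm (b k)) * C"
    by (simp add: suminf_mult2[OF assms(1)])
qed

text \<open>
  The estimate behind the gliding hump: replacing \<open>norm (a k)\<close> by \<open>a k * y k\<close> changes nothing on the
  block \<open>{K..<K'}\<close> and costs at most \<open>2 * norm (a k)\<close> at every other index.
\<close>
lemma norm_suminf_ge_if_phase_on_block:
  fixes a :: "nat \<Rightarrow> 'a::{real_normed_field, banach}"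
  assumes a: "summable (\<lambda>k. norm (a k))" and y: "\<And>k. norm (y k) \<le> 1"
    and blk: "\<And>k. K \<le> k \<Longrightarrow> k < K' \<Longrightarrow> y k = phase (a k)" and K: "K \<le> K'"
  shows "(\<Sum>k. norm (a k)) - 2 * (\<Sum>k<K. norm (a k)) - 2 * sum_from K' (\<lambda>k. norm (a k))
    \<le> norm (\<Sum>k. a k * y k)"
proof -
  define g where "g k = of_real (norm (a k)) - a k * y k" for k
  have g_le: "norm (g k) \<le> 2 * norm (a k)" for k
  proof -
    have "norm (g k) \<le> norm (of_real (norm (a k)) :: 'a) + norm (a k) * norm (y k)"
      unfolding g_def by (metis norm_mult norm_triangle_ineq4)
    also have "\<dots> \<le> 2 * norm (a k)"
      using mult_left_mono[OF y[of k], of "norm (a k)"] by simp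
    finally show ?thesis .
  qed
  have g0: "g k = 0" if "K \<le> k" "k < K'" for k
    using blk[OF that] by (simp add: g_def)
  have sm2: "summable (\<lambda>k. 2 * norm (a k))" using a by (rule summable_mult)
  have smg: "summable (\<lambda>k. norm (g k))"
    by (rule summable_comparison_test'[OF sm2]) (simp add: g_le)
  have sy: "summable (\<lambda>k. a k * y k)" by (rule abs_summable_mult_linf[OF a y])
  have "of_real (\<Sum>k. norm (a k)) = (\<Sum>k. of_real (norm (a k)) :: 'a)"
    by (rule suminf_of_real[OF a])
  also have "\<dots> = (\<Sum>k. g k + a k * y k)" by (simp add: g_def)
  also have "\<dots> = (\<Sum>k. g k) + (\<Sum>k. a k * y k)"
    by (rule suminf_add[symmetric, OF summable_norm_cancel[OF smg] sy])
  finally have eq: "of_real (\<Sum>k. norm (a k)) = (\<Sum>k. g k) + (\<Sum>k. a k * y k)" .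
  have "(\<Sum>k. norm (a k)) = norm (of_real (\<Sum>k. norm (a k)) :: 'a)"
    by (simp add: suminf_nonneg[OF a])
  also have "\<dots> \<le> norm (\<Sum>k. g k) + norm (\<Sum>k. a k * y k)"
    unfolding eq by (rule norm_triangle_ineq)
  also have "norm (\<Sum>k. g k) \<le> (\<Sum>k. norm (g k))" by (rule summable_norm[OF smg])
  also have "(\<Sum>k. norm (g k)) = (\<Sum>k<K'. norm (g k)) + sum_from K' (\<lambda>k. norm (g k))"
    by (rule sum_from_split[OF smg])
  also have "(\<Sum>k<K'. norm (g k)) = (\<Sum>k<K. norm (g k))"
    using K g0 by (intro sum.mono_neutral_right) auto
  also have "\<dots> \<le> (\<Sum>k<K. 2 * norm (a k))" by (intro sum_mono g_le)
  also have "sum_from K' (\<lambda>k. norm (g k)) \<le> sum_from K' (\<lambda>k. 2 * norm (a k))"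
    unfolding sum_from_def
    using summable_ignore_initial_segment[OF smg, of K'] summable_ignore_initial_segment[OF sm2, of K']
    by (intro suminf_le g_le) (simp_all add: add.commute)
  also have "\<dots> = 2 * sum_from K' (\<lambda>k. norm (a k))"
    unfolding sum_from_def
    using summable_ignore_initial_segment[OF a, of K'] by (subst suminf_mult) (simp_all add: add.commute)
  finally show ?thesis by (simp add: sum_distrib_left)
qed

text \<open>
  Schur's theorem.  If the \<open>l1\<close> norms do not tend to 0, then, since each column tends to 0, one can
  select rows of norm at least \<open>e\<close> whose mass is concentrated, up to a small part of \<open>e\<close>, on
  consecutive disjoint blocks.  The bounded sequence that takes the phases of the selected row on
  each block then pairs with all selected rows to values of modulus at least \<open>e / 2\<close>.
\<close>
lemma weakly_null_imp_l1_null: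
  fixes b :: "nat \<Rightarrow> nat \<Rightarrow> 'a::{real_normed_field, banach}"
  assumes sm: "\<And>n. summable (\<lambda>k. norm (b n k))"
    and weak: "\<And>y. y \<in> linf \<Longrightarrow> (\<lambda>n. \<Sum>k. b n k * y k) \<longlonglongrightarrow> 0"
  shows "(\<lambda>n. \<Sum>k. norm (b n k)) \<longlonglongrightarrow> 0"
proof (rule ccontr)
  define S where "S n = (\<Sum>k. norm (b n k))" for n
  have S0: "S n \<ge> 0" for n unfolding S_def by (rule suminf_nonneg[OF sm]) simp
  assume "\<not> (\<lambda>n. \<Sum>k. norm (b n k)) \<longlonglongrightarrow> 0"
  then obtain e where e: "e > 0" "\<And>M. \<exists>n\<ge>M. e \<le> S n"
    unfolding LIMSEQ_iff using S0 by (force simp: S_def[symmetric] not_less)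
  have col: "(\<lambda>n. b n k) \<longlonglongrightarrow> 0" for k
    using weak[OF unit_in_linf[of k]] by (simp add: suminf_mult_unit)
  (* The values outside the block enter the lower estimate with factor 2, so losing less than
     e / 8 on either side leaves e - 2 * (e / 8) - 2 * (e / 8) = e / 2. *)
  define good where "good n K K' \<longleftrightarrow> e \<le> S n \<and> (\<Sum>k<K. norm (b n k)) < e / 8
    \<and> sum_from K' (\<lambda>k. norm (b n k)) < e / 8" for n K K'
  have step: "\<exists>n K'. M < n \<and> K < K' \<and> good n K K'" for M K
  proof -
    have "(\<lambda>n. \<Sum>k<K. norm (b n k)) \<longlonglongrightarrow> 0"
      by (intro tendsto_null_sum tendsto_norm_zero col)
    then have "\<forall>\<^sub>F n in sequentially. (\<Sum>k<K. norm (b n k)) < e / 8"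
      by (rule order_tendstoD) (use e in simp)
    then obtain n0 where n0: "\<And>n. n \<ge> n0 \<Longrightarrow> (\<Sum>k<K. norm (b n k)) < e / 8"
      by (auto simp: eventually_sequentially)
    obtain n where n: "n \<ge> max n0 (Suc M)" "e \<le> S n" using e(2) by blast
    have "\<forall>\<^sub>F K' in sequentially. sum_from K' (\<lambda>k. norm (b n k)) < e / 8"
      by (rule order_tendstoD[OF sum_from_tendsto_0[OF sm]]) (use e in simp)
    then have "\<forall>\<^sub>F K' in sequentially. sum_from K' (\<lambda>k. norm (b n k)) < e / 8 \<and> K < K'"
      by (intro eventually_conj eventually_gt_at_top)
    then obtain K' where "sum_from K' (\<lambda>k. norm (b n k)) < e / 8" "K < K'"
      using eventually_happens' sequentially_bot by blast
    then show ?thesis using n n0[of n] by (intro exI[of _ n] exI[of _ K']) (auto simp: good_def)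
  qed
  obtain f :: "nat \<Rightarrow> nat \<times> nat" where
    f: "\<And>j. fst (f j) < fst (f (Suc j)) \<and> snd (f j) < snd (f (Suc j))
      \<and> good (fst (f (Suc j))) (snd (f j)) (snd (f (Suc j)))"
  proof -
    have "\<exists>q. fst p < fst q \<and> snd p < snd q \<and> good (fst q) (snd p) (snd q)" for p :: "nat \<times> nat"
      using step[of "fst p" "snd p"] by auto
    then show ?thesis
      using that dependent_nat_choice[of "\<lambda>_ _. True"
        "\<lambda>_ p q. fst p < fst q \<and> snd p < snd q \<and> good (fst q) (snd p) (snd q)"] by auto
  qed
  define nn where "nn j = fst (f (Suc j))" for j
  define K where "K j = snd (f j)" for j
  have nn: "strict_mono nn" and K: "strict_mono K"
    using f by (auto simp: strict_mono_Suc_iff nn_def K_def)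
  have good: "good (nn j) (K j) (K (Suc j))" for j using f by (simp add: nn_def K_def)
  (* The minimum is the number j of the block {K j..<K (Suc j)} that contains k. *)
  define y where "y k = phase (b (nn (LEAST i. k < K (Suc i))) k)" for k
  have y1: "norm (y k) \<le> 1" for k by (simp add: y_def norm_phase_le)
  have y: "y k = phase (b (nn j) k)" if "K j \<le> k" "k < K (Suc j)" for j k
  proof -
    have "(LEAST i. k < K (Suc i)) = j"
    proof (rule Least_equality)
      fix i assume "k < K (Suc i)"
      with that(1) have "K j < K (Suc i)" by simp
      then show "j \<le> i" using strict_mono_less[OF K] by auto
    qed (rule that)
    then show ?thesis by (simp add: y_def)
  qed
  have lower: "e / 2 \<le> norm (\<Sum>k. b (nn j) k * y k)" for j
  proof -
    have "K j \<le> K (Suc j)" using strict_mono_less_eq[OF K] by simp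
    from norm_suminf_ge_if_phase_on_block[where K = "K j" and K' = "K (Suc j)", OF sm[of "nn j"] y1 y this]
    show ?thesis using good[of j] by (simp add: good_def S_def)
  qed
  have "(\<lambda>j. \<Sum>k. b (nn j) k * y k) \<longlonglongrightarrow> 0"
    using LIMSEQ_subseq_LIMSEQ[OF weak[OF in_linfI[OF y1]] nn] by (simp add: o_def)
  then have "(\<lambda>j. norm (\<Sum>k. b (nn j) k * y k)) \<longlonglongrightarrow> 0" by (rule tendsto_norm_zero)
  then have "e / 2 \<le> 0" by (rule LIMSEQ_le_const) (use lower in blast)
  with e show False by simp
qed

lemma linf_to_c0_iff:
  fixes b :: "nat \<Rightarrow> nat \<Rightarrow> 'a::{real_normed_field, banach}"
  assumes sm: "\<And>n. summable (\<lambda>k. norm (b n k))"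
  shows "(\<forall>y\<in>linf. (\<lambda>n. \<Sum>k. b n k * y k) \<in> c0) \<longleftrightarrow> (\<lambda>n. \<Sum>k. norm (b n k)) \<longlonglongrightarrow> 0"
proof
  assume "\<forall>y\<in>linf. (\<lambda>n. \<Sum>k. b n k * y k) \<in> c0"
  then show "(\<lambda>n. \<Sum>k. norm (b n k)) \<longlonglongrightarrow> 0"
    by (intro weakly_null_imp_l1_null[OF sm]) (auto simp: c0_def)
next
  assume lim: "(\<lambda>n. \<Sum>k. norm (b n k)) \<longlonglongrightarrow> 0"
  show "\<forall>y\<in>linf. (\<lambda>n. \<Sum>k. b n k * y k) \<in> c0"
  proof
    fix y :: "nat \<Rightarrow> 'a" assume "y \<in> linf"
    then obtain C where C: "\<And>k. norm (y k) \<le> C" by (rule in_linfE) blast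
    have "(\<lambda>n. \<Sum>k. b n k * y k) \<longlonglongrightarrow> 0"
      by (rule Lim_null_comparison[OF _ tendsto_mult_left_zero[OF lim, of C]])
        (simp add: abs_summable_mult_linf(2)[OF sm C])
    then show "(\<lambda>n. \<Sum>k. b n k * y k) \<in> c0" by (simp add: c0_def)
  qed
qed

text \<open>
  Necessity is uniform boundedness: rows with norms tending to infinity, normalised to have norm 1,
  would still pair with every bounded sequence to a null sequence, against Schur's theorem.
\<close>
lemma linf_to_linf_iff:
  fixes b :: "nat \<Rightarrow> nat \<Rightarrow> 'a::{real_normed_field, banach}"
  assumes sm: "\<And>n. summable (\<lambda>k. norm (b n k))"
  shows "(\<forall>y\<in>linf. (\<lambda>n. \<Sum>k. b n k * y k) \<in> linf)
    \<longleftrightarrow> bdd_above (range (\<lambda>n. \<Sum>k. norm (b n k)))"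
proof
  assume "bdd_above (range (\<lambda>n. \<Sum>k. norm (b n k)))"
  then obtain S where S: "\<And>n. (\<Sum>k. norm (b n k)) \<le> S" by (auto simp: bdd_above_def)
  show "\<forall>y\<in>linf. (\<lambda>n. \<Sum>k. b n k * y k) \<in> linf"
  proof
    fix y :: "nat \<Rightarrow> 'a" assume "y \<in> linf"
    then obtain C where C: "C > 0" "\<And>k. norm (y k) \<le> C" by (rule in_linfE) blast
    show "(\<lambda>n. \<Sum>k. b n k * y k) \<in> linf"
      using abs_summable_mult_linf(2)[OF sm C(2)] mult_right_mono[OF S, of C] C(1)
      by (intro in_linfI[of _ "S * C"]) (meson less_imp_le order_trans)
  qed
next
  assume bdd: "\<forall>y\<in>linf. (\<lambda>n. \<Sum>k. b n k * y k) \<in> linf"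
  define S where "S n = (\<Sum>k. norm (b n k))" for n
  show "bdd_above (range (\<lambda>n. \<Sum>k. norm (b n k)))"
  proof (rule ccontr)
    assume "\<not> bdd_above (range (\<lambda>n. \<Sum>k. norm (b n k)))"
    then have "\<exists>n. real (Suc j) \<le> S n" for j
      unfolding bdd_above_def S_def[symmetric] by (auto simp: not_le) (meson less_imp_le)
    then obtain q where q: "\<And>j. real (Suc j) \<le> S (q j)" by metis
    have pos: "S (q j) > 0" for j using q[of j] by linarith
    define c where "c j k = b (q j) k * of_real (1 / S (q j))" for j k
    have nc: "norm (c j k) = norm (b (q j) k) * (1 / S (q j))" for j k
      using pos[of j] by (simp add: c_def norm_mult norm_divide)
    have "(\<lambda>j. \<Sum>k. norm (c j k)) \<longlonglongrightarrow> 0"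
    proof (rule weakly_null_imp_l1_null)
      show "summable (\<lambda>k. norm (c j k))" for j
        unfolding nc by (rule summable_mult2[OF sm])
      fix y :: "nat \<Rightarrow> 'a" assume y: "y \<in> linf"
      then obtain C where C: "\<And>k. norm (y k) \<le> C" by (rule in_linfE) blast
      from bdd y have "(\<lambda>n. \<Sum>k. b n k * y k) \<in> linf" by blast
      then obtain M where M: "M > 0" "\<And>n. norm (\<Sum>k. b n k * y k) \<le> M" by (rule in_linfE) blast
      have "norm (\<Sum>k. c j k * y k) \<le> M * inverse (real (Suc j))" for j
      proof -
        have "(\<Sum>k. c j k * y k) = (\<Sum>k. b (q j) k * y k * of_real (1 / S (q j)))"
          by (simp add: c_def mult_ac)
        also have "\<dots> = (\<Sum>k. b (q j) k * y k) * of_real (1 / S (q j))"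
          by (rule suminf_mult2[symmetric, OF abs_summable_mult_linf(1)[OF sm C]])
        finally have "norm (\<Sum>k. c j k * y k) = norm (\<Sum>k. b (q j) k * y k) * (1 / S (q j))"
          using pos[of j] by (simp add: norm_mult norm_divide)
        also have "\<dots> \<le> M * inverse (real (Suc j))"
          using M pos[of j] q[of j]
          by (intro mult_mono) (auto simp: divide_inverse simp del: of_nat_Suc intro!: le_imp_inverse_le)
        finally show ?thesis .
      qed
      then show "(\<lambda>j. \<Sum>k. c j k * y k) \<longlonglongrightarrow> 0"
        by (intro Lim_null_comparison[OF _ tendsto_mult_right_zero[OF LIMSEQ_inverse_real_of_nat, of M]]) simp
    qed
    moreover have "(\<Sum>k. norm (c j k)) = 1" for j
      unfolding nc suminf_mult2[symmetric, OF sm] S_def[symmetric] using pos[of j] by simp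
    ultimately show False by (simp add: LIMSEQ_const_iff)
  qed
qed

text \<open>
  The differences \<open>b n - l\<close> map bounded sequences to null sequences, and \<open>l\<close> pairs with \<open>y\<close> to a
  convergent series because both \<open>b 0\<close> and \<open>b 0 - l\<close> are in \<open>l1\<close>.
\<close>
lemma l1_limit_suminf:
  fixes b :: "nat \<Rightarrow> nat \<Rightarrow> 'a::{real_normed_field, banach}"
  assumes sm: "\<And>n. summable (\<lambda>k. norm (b n k))"
    and sd: "\<And>n. summable (\<lambda>k. norm (b n k - l k))"
    and lim: "(\<lambda>n. \<Sum>k. norm (b n k - l k)) \<longlonglongrightarrow> 0" and y: "y \<in> linf"
  shows "(\<lambda>n. \<Sum>k. b n k * y k) \<longlonglongrightarrow> (\<Sum>k. l k * y k)"
proof -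
  obtain C where C: "\<And>k. norm (y k) \<le> C" using y by (rule in_linfE) blast
  have "summable (\<lambda>k. b 0 k * y k - (b 0 k - l k) * y k)"
    by (intro summable_diff abs_summable_mult_linf(1)[OF _ C] sm sd)
  then have sl: "summable (\<lambda>k. l k * y k)" by (simp add: algebra_simps)
  have "(\<Sum>k. b n k * y k) - (\<Sum>k. l k * y k) = (\<Sum>k. (b n k - l k) * y k)" for n
    using suminf_diff[OF abs_summable_mult_linf(1)[OF sm[of n] C] sl] by (simp add: left_diff_distrib)
  then show ?thesis
    using lim linf_to_c0_iff[of "\<lambda>n k. b n k - l k", OF sd] y
    by (simp add: LIM_zero_iff[symmetric, of _ "\<Sum>k. l k * y k"] c0_def)
qed

text \<open>
  Necessity: differences of rows with indices tending to infinity pair with every bounded sequence to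
  a null sequence, so by Schur's theorem the rows form a Cauchy sequence in \<open>l1\<close>.  Its limit in \<open>l1\<close>
  has to be the columnwise limit.
\<close>
lemma linf_to_cs_iff:
  fixes b :: "nat \<Rightarrow> nat \<Rightarrow> 'a::{real_normed_field, banach}"
  assumes sm: "\<And>n. summable (\<lambda>k. norm (b n k))"
  shows "(\<forall>y\<in>linf. (\<lambda>n. \<Sum>k. b n k * y k) \<in> cs) \<longleftrightarrow>
    (\<forall>k. convergent (\<lambda>n. b n k))
    \<and> (\<forall>n. summable (\<lambda>k. norm (b n k - lim (\<lambda>n'. b n' k))))
    \<and> (\<lambda>n. \<Sum>k. norm (b n k - lim (\<lambda>n'. b n' k))) \<longlonglongrightarrow> 0"
proof
  assume "(\<forall>k. convergent (\<lambda>n. b n k))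
    \<and> (\<forall>n. summable (\<lambda>k. norm (b n k - lim (\<lambda>n'. b n' k))))
    \<and> (\<lambda>n. \<Sum>k. norm (b n k - lim (\<lambda>n'. b n' k))) \<longlonglongrightarrow> 0"
  then show "\<forall>y\<in>linf. (\<lambda>n. \<Sum>k. b n k * y k) \<in> cs"
    using l1_limit_suminf[OF sm] by (fastforce simp: cs_def convergent_def)
next
  assume conv: "\<forall>y\<in>linf. (\<lambda>n. \<Sum>k. b n k * y k) \<in> cs"
  define l where "l k = lim (\<lambda>n. b n k)" for k
  have col: "convergent (\<lambda>n. b n k)" for k
    using conv unit_in_linf[of k] by (auto simp: cs_def suminf_mult_unit)
  have l: "(\<lambda>n. b n k) \<longlonglongrightarrow> l k" for k
    using col[of k] by (simp add: l_def convergent_LIMSEQ_iff)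
  have sd: "summable (\<lambda>k. norm (b m k - b n k))" for m n
    by (rule summable_comparison_test'[OF summable_add[OF sm[of m] sm[of n]]])
      (simp add: norm_triangle_ineq4)
  have cauchy: "\<exists>M. \<forall>m\<ge>M. \<forall>n\<ge>M. (\<Sum>k. norm (b m k - b n k)) < e" if "e > 0" for e
  proof (rule ccontr)
    assume "\<nexists>M. \<forall>m\<ge>M. \<forall>n\<ge>M. (\<Sum>k. norm (b m k - b n k)) < e"
    then have "\<forall>M. \<exists>m n. m \<ge> M \<and> n \<ge> M \<and> e \<le> (\<Sum>k. norm (b m k - b n k))"
      by (meson not_less)
    then obtain p q where pq: "\<And>M. p M \<ge> M" "\<And>M. q M \<ge> M"
      "\<And>M. e \<le> (\<Sum>k. norm (b (p M) k - b (q M) k))" by metis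
    have top: "filterlim p at_top sequentially" "filterlim q at_top sequentially"
      using pq by (auto intro: filterlim_at_top_mono[OF filterlim_ident])
    have "(\<lambda>M. \<Sum>k. norm (b (p M) k - b (q M) k)) \<longlonglongrightarrow> 0"
    proof (rule weakly_null_imp_l1_null[OF sd])
      fix y :: "nat \<Rightarrow> 'a" assume y: "y \<in> linf"
      then obtain C where C: "\<And>k. norm (y k) \<le> C" by (rule in_linfE) blast
      from conv y obtain L where L: "(\<lambda>n. \<Sum>k. b n k * y k) \<longlonglongrightarrow> L"
        by (auto simp: cs_def convergent_def)
      have "(\<Sum>k. (b (p M) k - b (q M) k) * y k) = (\<Sum>k. b (p M) k * y k) - (\<Sum>k. b (q M) k * y k)" for M
        using suminf_diff[OF abs_summable_mult_linf(1)[OF sm[of "p M"] C]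
          abs_summable_mult_linf(1)[OF sm[of "q M"] C]]
        by (simp add: left_diff_distrib)
      moreover have "(\<lambda>M. (\<Sum>k. b (p M) k * y k) - (\<Sum>k. b (q M) k * y k)) \<longlonglongrightarrow> L - L"
        by (intro tendsto_diff filterlim_compose[OF L] top)
      ultimately show "(\<lambda>M. \<Sum>k. (b (p M) k - b (q M) k) * y k) \<longlonglongrightarrow> 0" by simp
    qed
    then have "e \<le> 0" by (rule LIMSEQ_le_const) (use pq(3) in blast)
    with \<open>e > 0\<close> show False by simp
  qed
  have tail: "summable (\<lambda>k. norm (b m k - l k)) \<and> (\<Sum>k. norm (b m k - l k)) \<le> e"
    if M: "\<forall>m\<ge>M. \<forall>n\<ge>M. (\<Sum>k. norm (b m k - b n k)) < e" and m: "m \<ge> M" for m M e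
  proof -
    have part: "(\<Sum>k<K. norm (b m k - l k)) \<le> e" for K
    proof (rule LIMSEQ_le_const2)
      show "(\<lambda>n. \<Sum>k<K. norm (b m k - b n k)) \<longlonglongrightarrow> (\<Sum>k<K. norm (b m k - l k))"
        by (intro tendsto_intros l)
      show "\<exists>N. \<forall>n\<ge>N. (\<Sum>k<K. norm (b m k - b n k)) \<le> e"
      proof (intro exI allI impI)
        fix n assume "n \<ge> M"
        then have "(\<Sum>k. norm (b m k - b n k)) < e" using M m by blast
        moreover have "(\<Sum>k<K. norm (b m k - b n k)) \<le> (\<Sum>k. norm (b m k - b n k))"
          by (rule sum_le_suminf[OF sd]) auto
        ultimately show "(\<Sum>k<K. norm (b m k - b n k)) \<le> e" by linarith
      qed
    qed
    have "summable (\<lambda>k. norm (b m k - l k))"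
      by (rule summableI_nonneg_bounded[OF _ part]) simp
    then show ?thesis using part by (auto intro: suminf_le_const)
  qed
  obtain M1 where M1: "\<forall>m\<ge>M1. \<forall>n\<ge>M1. (\<Sum>k. norm (b m k - b n k)) < 1" using cauchy[of 1] by auto
  have sl: "summable (\<lambda>k. norm (b n k - l k))" for n
  proof (rule summable_comparison_test')
    show "summable (\<lambda>k. norm (b n k - b M1 k) + norm (b M1 k - l k))"
      using tail[OF M1, of M1] sd by (intro summable_add) auto
    show "norm (norm (b n k - l k)) \<le> norm (b n k - b M1 k) + norm (b M1 k - l k)" if "k \<ge> 0" for k
      using norm_triangle_ineq[of "b n k - b M1 k" "b M1 k - l k"] by simp
  qed
  have "(\<lambda>n. \<Sum>k. norm (b n k - l k)) \<longlonglongrightarrow> 0"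
  proof (rule LIMSEQ_I)
    fix e :: real assume "e > 0"
    then obtain M where M: "\<forall>m\<ge>M. \<forall>n\<ge>M. (\<Sum>k. norm (b m k - b n k)) < e / 2"
      using cauchy[of "e / 2"] by auto
    have "norm ((\<Sum>k. norm (b m k - l k)) - 0) < e" if "m \<ge> M" for m
      using tail[OF M that] suminf_nonneg[OF sl[of m]] \<open>e > 0\<close> by simp
    then show "\<exists>no. \<forall>n\<ge>no. norm ((\<Sum>k. norm (b n k - l k)) - 0) < e" by blast
  qed
  then show "(\<forall>k. convergent (\<lambda>n. b n k))
    \<and> (\<forall>n. summable (\<lambda>k. norm (b n k - lim (\<lambda>n'. b n' k))))
    \<and> (\<lambda>n. \<Sum>k. norm (b n k - lim (\<lambda>n'. b n' k))) \<longlonglongrightarrow> 0"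
    using col sl by (simp add: l_def)
qed

section \<open>The reciprocal power series and the inverse transform\<close>

text \<open>
  The matrix in the definition of \<^const>\<open>D\<close>, over an integral domain because the theorem on
  determinants of block triangular matrices holds there.
\<close>
definition toeplitz_hessenberg :: "(nat \<Rightarrow> 'a::idom) \<Rightarrow> nat \<Rightarrow> 'a mat"
  where "toeplitz_hessenberg f n = mat n n (\<lambda>(i, j). if j \<le> i + 1 then f (i + 1 - j) else 0)"

text \<open>
  Laplace expansion along the first column.  Deleting row \<open>i\<close> leaves a block lower triangular matrix:
  an \<open>i \<times> i\<close> lower triangular block with diagonal \<open>f 0\<close>, followed by a smaller matrix of the
  original kind.
\<close>
lemma det_toeplitz_hessenberg_Suc:
  fixes f :: "nat \<Rightarrow> 'a::idom"
  shows "Determinant.det (toeplitz_hessenberg f (Suc n)) =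
    (\<Sum>i\<le>n. (-1) ^ i * f (i + 1) * f 0 ^ i * Determinant.det (toeplitz_hessenberg f (n - i)))"
proof -
  let ?H = "toeplitz_hessenberg f"
  have minor: "Determinant.det (mat_delete (?H (Suc n)) i 0) = f 0 ^ i * Determinant.det (?H (n - i))"
    if "i \<le> n" for i
  proof -
    define L where "L = mat i i (\<lambda>(p, q). if q \<le> p then f (p - q) else 0)"
    define B where "B = mat (n - i) i (\<lambda>(p, q). f (i + p + 1 - q))"
    have "mat_delete (?H (Suc n)) i 0 = four_block_mat L (0\<^sub>m i (n - i)) B (?H (n - i))"
    proof (rule eq_matI)
      fix p q
      assume "p < dim_row (four_block_mat L (0\<^sub>m i (n - i)) B (?H (n - i)))"
        and "q < dim_col (four_block_mat L (0\<^sub>m i (n - i)) B (?H (n - i)))"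
      then have pq: "p < n" "q < n" 
        using that by (auto simp: L_def toeplitz_hessenberg_def)
      show "mat_delete (?H (Suc n)) i 0 $$ (p, q)
          = four_block_mat L (0\<^sub>m i (n - i)) B (?H (n - i)) $$ (p, q)"
        using pq that
        by (auto simp: mat_delete_def L_def B_def toeplitz_hessenberg_def intro!: arg_cong[where f=f])
    qed (use that in \<open>auto simp: L_def toeplitz_hessenberg_def\<close>)
    moreover have "Determinant.det \<dots> = Determinant.det L * Determinant.det (?H (n - i))"
      by (rule det_four_block_mat_upper_right_zero) (auto simp: L_def B_def toeplitz_hessenberg_def)
    moreover have "Determinant.det L = prod_list (diag_mat L)"
      by (rule det_lower_triangular[of i]) (auto simp: L_def)
    moreover have "diag_mat L = replicate i (f 0)"
      by (rule nth_equalityI) (auto simp: diag_mat_def L_def)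
    ultimately show ?thesis by simp
  qed
  have first_column: "?H (Suc n) $$ (i, 0) = f (Suc i)" if "i \<le> n" for i
    using that by (simp add: toeplitz_hessenberg_def)
  have "Determinant.det (?H (Suc n)) = (\<Sum>i<Suc n. ?H (Suc n) $$ (i, 0) * cofactor (?H (Suc n)) i 0)"
    by (rule laplace_expansion_column) (auto simp: toeplitz_hessenberg_def)
  also have "\<dots> = (\<Sum>i\<le>n. (-1) ^ i * f (i + 1) * f 0 ^ i * Determinant.det (?H (n - i)))"
    unfolding lessThan_Suc_atMost
    by (intro sum.cong refl) (simp add: cofactor_def minor first_column)
  finally show ?thesis .
qed

lemma D_eq_det: "D s n = Determinant.det (toeplitz_hessenberg s n) / s 0 ^ (n + 1)"
  by (simp add: D_def toeplitz_hessenberg_def)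

lemma D_Suc:
  assumes "s 0 \<noteq> 0"
  shows "s 0 * D s (Suc n) = (\<Sum>i\<le>n. (-1) ^ i * s (i + 1) * D s (n - i))"
proof -
  have "s 0 * D s (Suc n) = (\<Sum>i\<le>n. (-1) ^ i * s (i + 1) * s 0 ^ i
      * Determinant.det (toeplitz_hessenberg s (n - i)) / s 0 ^ (n + 1))"
    using assms by (simp add: D_eq_det[of s "Suc n"] det_toeplitz_hessenberg_Suc flip: sum_divide_distrib)
  also have "\<dots> = (\<Sum>i\<le>n. (-1) ^ i * s (i + 1) * D s (n - i))"
  proof (intro sum.cong refl)
    fix i assume "i \<in> {..n}"
    then have "s 0 ^ (n + 1) = s 0 ^ i * s 0 ^ (n - i + 1)" by (simp flip: power_add)
    then show "(-1) ^ i * s (i + 1) * s 0 ^ i * Determinant.det (toeplitz_hessenberg s (n - i))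
        / s 0 ^ (n + 1) = (-1) ^ i * s (i + 1) * D s (n - i)"
      using assms by (simp add: D_eq_det)
  qed
  finally show ?thesis .
qed

definition recip_coeff :: "(nat \<Rightarrow> 'a::real_normed_field) \<Rightarrow> nat \<Rightarrow> 'a"
  where "recip_coeff s l = (-1) ^ l * D s l"

text \<open>
  The recurrence \<open>D_Suc\<close> says that the Cauchy product has no coefficients beyond the constant one.
\<close>
lemma fps_recip_coeff:
  assumes "s 0 \<noteq> 0"
  shows "Abs_fps s * Abs_fps (recip_coeff s) = 1"
proof (rule fps_ext)
  fix n
  show "fps_nth (Abs_fps s * Abs_fps (recip_coeff s)) n = fps_nth 1 n"
  proof (cases n)
    case 0
    then show ?thesis using assms by (simp add: recip_coeff_def D_def)
  next
    case (Suc m)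
    have "fps_nth (Abs_fps s * Abs_fps (recip_coeff s)) n
        = s 0 * recip_coeff s (Suc m) + (\<Sum>i\<le>m. s (i + 1) * recip_coeff s (m - i))"
      by (simp add: Suc fps_mult_nth atLeast0AtMost sum.atMost_Suc_shift del: sum.atMost_Suc)
    also have "s 0 * recip_coeff s (Suc m) = (-1) ^ Suc m * (s 0 * D s (Suc m))"
      by (simp add: recip_coeff_def)
    also have "\<dots> = - (\<Sum>i\<le>m. (-1) ^ m * ((-1) ^ i * s (i + 1) * D s (m - i)))"
      by (simp add: D_Suc[of s, OF assms] sum_distrib_left sum_negf)
    also have "(\<Sum>i\<le>m. (-1) ^ m * ((-1) ^ i * s (i + 1) * D s (m - i)))
        = (\<Sum>i\<le>m. s (i + 1) * recip_coeff s (m - i))"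
    proof (intro sum.cong refl)
      fix i assume "i \<in> {..m}"
      then have "(-1 :: 'a) ^ (m - i) = (-1) ^ m * (-1) ^ i"
        by (auto simp: minus_one_power_iff)
      then show "(-1) ^ m * ((-1) ^ i * s (i + 1) * D s (m - i)) = s (i + 1) * recip_coeff s (m - i)"
        by (simp add: recip_coeff_def)
    qed
    finally show ?thesis by (simp add: Suc)
  qed
qed

lemma convolution_eq_iff:
  assumes "s 0 \<noteq> 0"
  shows "(\<forall>n. (\<Sum>k=0..n. s (n - k) * z k) = u n)
    \<longleftrightarrow> (\<forall>k. z k = (\<Sum>i\<le>k. recip_coeff s (k - i) * u i))"
proof -
  have conv: "fps_nth (Abs_fps p * Abs_fps q) n = (\<Sum>k=0..n. p (n - k) * q k)" for p q :: "nat \<Rightarrow> 'a" and n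
    using fps_mult_nth[of "Abs_fps q" "Abs_fps p" n] by (simp add: mult.commute)
  have "(\<forall>n. (\<Sum>k=0..n. s (n - k) * z k) = u n) \<longleftrightarrow> Abs_fps s * Abs_fps z = Abs_fps u"
    by (simp add: fps_eq_iff conv)
  also have "\<dots> \<longleftrightarrow> Abs_fps z = Abs_fps (recip_coeff s) * Abs_fps u"
  proof
    assume u: "Abs_fps s * Abs_fps z = Abs_fps u"
    have "Abs_fps (recip_coeff s) * Abs_fps u = (Abs_fps s * Abs_fps (recip_coeff s)) * Abs_fps z"
      by (simp only: u[symmetric] mult_ac)
    then show "Abs_fps z = Abs_fps (recip_coeff s) * Abs_fps u"
      by (simp only: fps_recip_coeff[of s, OF assms] mult_1_left)
  next
    assume z: "Abs_fps z = Abs_fps (recip_coeff s) * Abs_fps u"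
    have "Abs_fps s * Abs_fps z = (Abs_fps s * Abs_fps (recip_coeff s)) * Abs_fps u"
      by (simp only: z mult_ac)
    then show "Abs_fps s * Abs_fps z = Abs_fps u"
      by (simp only: fps_recip_coeff[of s, OF assms] mult_1_left)
  qed
  also have "\<dots> \<longleftrightarrow> (\<forall>k. z k = (\<Sum>i\<le>k. recip_coeff s (k - i) * u i))"
    by (simp add: fps_eq_iff conv atLeast0AtMost)
  finally show ?thesis .
qed

text \<open>
  The inverse of the map that sends \<open>x\<close> to the sequence required to be bounded in \<^const>\<open>linf_diff\<close>.
\<close>
definition inverse_transform ::
    "(nat \<Rightarrow> 'a::real_normed_field) \<Rightarrow> (nat \<Rightarrow> 'a) \<Rightarrow> (nat \<Rightarrow> 'a) \<Rightarrow> (nat \<Rightarrow> 'a) \<Rightarrow> nat \<Rightarrow> 'a"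
  where "inverse_transform r s t y j =
    (\<Sum>k\<le>j. (\<Sum>i\<le>k. recip_coeff s (k - i) * (r i * y i)) / t k)"

lemma bdiff_eq_iff: "(\<forall>k. bdiff x k = v k) \<longleftrightarrow> (\<forall>j. x j = (\<Sum>k\<le>j. v k))"
proof
  assume v: "\<forall>k. bdiff x k = v k"
  show "\<forall>j. x j = (\<Sum>k\<le>j. v k)"
  proof
    fix j show "x j = (\<Sum>k\<le>j. v k)"
      by (induction j) (auto simp: bdiff_def simp flip: v[rule_format])
  qed
next
  assume x: "\<forall>j. x j = (\<Sum>k\<le>j. v k)"
  show "\<forall>k. bdiff x k = v k"
  proof
    fix k show "bdiff x k = v k"
      by (cases k) (auto simp: bdiff_def x[rule_format])
  qed
qed

lemma linf_diff_eq_image: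
  assumes r: "\<And>n. r n \<noteq> 0" and t: "\<And>n. t n \<noteq> 0" and s: "s 0 \<noteq> 0"
  shows "linf_diff r s t = inverse_transform r s t ` linf"
proof -
  define F where "F x = (\<lambda>n. 1 / r n * (\<Sum>k=0..n. s (n - k) * t k * bdiff x k))" for x
  have iff: "F x = y
      \<longleftrightarrow> x = inverse_transform r s t y" for x y
  proof -
    have "F x = y
        \<longleftrightarrow> (\<forall>n. (\<Sum>k=0..n. s (n - k) * (t k * bdiff x k)) = r n * y n)"
      using r by (simp add: F_def fun_eq_iff field_simps)
    also have "\<dots> \<longleftrightarrow> (\<forall>k. bdiff x k = (\<Sum>i\<le>k. recip_coeff s (k - i) * (r i * y i)) / t k)"
      unfolding convolution_eq_iff[of s, OF s] using t by (simp add: field_simps)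
    also have "\<dots> \<longleftrightarrow> x = inverse_transform r s t y"
      unfolding bdiff_eq_iff by (simp add: fun_eq_iff inverse_transform_def)
    finally show ?thesis .
  qed
  have "linf_diff r s t = {x. F x \<in> linf}" by (simp add: linf_diff_def F_def)
  also have "\<dots> = inverse_transform r s t ` linf"
    unfolding set_eq_iff image_iff iff[symmetric] by auto
  finally show ?thesis .
qed

section \<open>Truncated rows\<close>

lemma sum_from_cut_eq: "sum_from m (cut N a) = (\<Sum>j=m..N. a j)"
proof -
  have "sum_from m (cut N a) = (\<Sum>j\<in>{j. m + j \<le> N}. a (m + j))"
  proof -
    have "finite {j. m + j \<le> N}" by (rule finite_subset[of _ "{..N}"]) auto
    then show ?thesis
      unfolding sum_from_def by (subst suminf_finite) (auto simp: cut_def)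
  qed
  also have "\<dots> = (\<Sum>j=m..N. a j)"
    by (rule sum.reindex_bij_witness[of _ "\<lambda>j. j - m" "\<lambda>j. m + j"]) auto
  finally show ?thesis .
qed

lemma summable_cut:
  "summable (cut N a)"
  "summable (\<lambda>l. c l * sum_from (k + l) (cut N a))"
proof -
  show "summable (cut N a)"
    by (rule summable_finite[of "{..N}"]) (auto simp: cut_def)
  show "summable (\<lambda>l. c l * sum_from (k + l) (cut N a))"
    by (rule summable_finite[of "{..N}"]) (auto simp: sum_from_cut_eq)
qed

text \<open>
  The bound \<open>L\<close> of the summation is left free, as all terms with \<open>k + l > N\<close> vanish: for the
  comparison with \<open>w_formula\<close> it has to be the upper bound of the finite sum there.
\<close>
lemma R_formula_cut_upto:
  fixes a :: "nat \<Rightarrow> 'a::{real_normed_field, banach}"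
  assumes "N \<le> k + L"
  shows "R_formula r s t (cut N a) k
    = r k * (\<Sum>l=0..L. recip_coeff s l / t (l + k) * (\<Sum>j=k + l..N. a j))"
proof -
  have "R_formula r s t (cut N a) k
      = r k * (\<Sum>l. (-1) ^ l * (D s l / t (l + k)) * sum_from (k + l) (cut N a))"
    by (intro R_formula_eq summable_cut)
  also have "\<dots> = r k * (\<Sum>l. recip_coeff s l / t (l + k) * sum_from (k + l) (cut N a))"
    by (simp add: recip_coeff_def)
  also have "(\<Sum>l. recip_coeff s l / t (l + k) * sum_from (k + l) (cut N a))
      = (\<Sum>l=0..L. recip_coeff s l / t (l + k) * sum_from (k + l) (cut N a))"
    using assms by (intro suminf_finite) (auto simp: sum_from_cut_eq)
  finally show ?thesis by (simp add: sum_from_cut_eq)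
qed

lemma R_formula_cut:
  fixes a :: "nat \<Rightarrow> 'a::{real_normed_field, banach}"
  shows "R_formula r s t (cut N a) k
    = r k * (\<Sum>j=k..N. recip_coeff s (j - k) / t j * (\<Sum>i=j..N. a i))"
proof -
  have "(\<Sum>l=0..N. recip_coeff s l / t (l + k) * (\<Sum>j=k + l..N. a j))
      = (\<Sum>l\<in>{l. k + l \<le> N}. recip_coeff s l / t (l + k) * (\<Sum>j=k + l..N. a j))"
    by (rule sum.mono_neutral_right) auto
  also have "\<dots> = (\<Sum>j=k..N. recip_coeff s (j - k) / t j * (\<Sum>i=j..N. a i))"
    by (rule sum.reindex_bij_witness[of _ "\<lambda>j. j - k" "\<lambda>l. k + l"]) (auto simp: add.commute)
  finally show ?thesis by (simp add: R_formula_cut_upto[of N k N])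
qed

lemma R_formula_cut_eq_0:
  fixes a :: "nat \<Rightarrow> 'a::{real_normed_field, banach}"
  shows "N < k \<Longrightarrow> R_formula r s t (cut N a) k = 0"
  by (simp add: R_formula_cut)

text \<open>
  In \<open>w_formula\<close> the tails over \<open>j \<ge> k + l\<close> are replaced by tails over \<open>j > m\<close> as long as
  \<open>k + l \<le> m + 1\<close>.  This removes exactly the terms with \<open>j \<le> m\<close>, which make up the
  expression for the row cut off after \<open>m\<close>.
\<close>
lemma w_formula_cut_Suc:
  fixes a :: "nat \<Rightarrow> 'a::{real_normed_field, banach}"
  assumes "k \<le> Suc m" "m \<le> N"
  shows "w_formula r s t (cut N a) (Suc m) k
    = R_formula r s t (cut N a) k - R_formula r s t (cut m a) k"
proof -
  have "(\<Sum>l=0..Suc m - k. recip_coeff s l / t (l + k) * ((\<Sum>j=Suc m..N. a j) - (\<Sum>j=k + l..N. a j)))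
      = (\<Sum>l=0..Suc m - k. - (recip_coeff s l / t (l + k) * (\<Sum>j=k + l..m. a j)))"
  proof (intro sum.cong refl)
    fix l assume "l \<in> {0..Suc m - k}"
    then have "(\<Sum>j=k + l..N. a j) = (\<Sum>j=k + l..m. a j) + (\<Sum>j=Suc m..N. a j)"
      using assms
      by (subst sum.union_disjoint[symmetric]) (auto intro!: sum.cong)
    then show "recip_coeff s l / t (l + k) * ((\<Sum>j=Suc m..N. a j) - (\<Sum>j=k + l..N. a j))
        = - (recip_coeff s l / t (l + k) * (\<Sum>j=k + l..m. a j))"
      by (simp add: algebra_simps)
  qed
  then have "r k * (\<Sum>l=0..Suc m - k. recip_coeff s l / t (l + k)
      * ((\<Sum>j=Suc m..N. a j) - (\<Sum>j=k + l..N. a j))) = - R_formula r s t (cut m a) k"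
    using assms(1) by (subst R_formula_cut_upto[of m k "Suc m - k"]) (auto simp: sum_negf)
  moreover have "w_formula r s t (cut N a) (Suc m) k = R_formula r s t (cut N a) k
      + r k * (\<Sum>l=0..Suc m - k. (-1) ^ l * (D s l / t (l + k))
          * (sum_from (Suc m) (cut N a) - sum_from (k + l) (cut N a)))"
    by (intro w_formula_eq summable_cut assms)
  ultimately show ?thesis by (simp add: sum_from_cut_eq recip_coeff_def)
qed

lemma w_formula_cut_0:
  fixes a :: "nat \<Rightarrow> 'a::{real_normed_field, banach}"
  shows "w_formula r s t (cut N a) 0 0 = R_formula r s t (cut N a) 0"
proof -
  have "w_formula r s t (cut N a) 0 0 = R_formula r s t (cut N a) 0
      + r 0 * (\<Sum>l=0..0 - 0. (-1) ^ l * (D s l / t (l + 0))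
          * (sum_from 0 (cut N a) - sum_from (0 + l) (cut N a)))"
    by (intro w_formula_eq summable_cut order_refl)
  then show ?thesis by simp
qed

text \<open>
  Two interchanges of finite sums: \<open>inverse_transform\<close> is a sum of sums, and collecting the factor of each \<open>y k\<close>
  produces the nested sums of \<open>R_formula_cut\<close>.
\<close>
lemma partial_sum_eq:
  fixes a :: "nat \<Rightarrow> 'a::{real_normed_field, banach}"
  shows "(\<Sum>j\<le>N. a j * inverse_transform r s t y j)
    = (\<Sum>k\<le>N. R_formula r s t (cut N a) k * y k)"
proof -
  let ?z = "\<lambda>k. \<Sum>i\<le>k. recip_coeff s (k - i) * (r i * y i)"
  have "(\<Sum>j\<le>N. a j * inverse_transform r s t y j)
      = (\<Sum>j\<le>N. \<Sum>k\<in>{k \<in> {..N}. k \<le> j}. a j * (?z k / t k))"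
    unfolding inverse_transform_def sum_distrib_left
    by (intro sum.cong refl) auto
  also have "\<dots> = (\<Sum>k\<le>N. \<Sum>j\<in>{j \<in> {..N}. k \<le> j}. a j * (?z k / t k))"
    by (rule sum.swap_restrict) auto
  also have "\<dots> = (\<Sum>k\<le>N. \<Sum>i\<in>{i \<in> {..N}. i \<le> k}.
      recip_coeff s (k - i) / t k * (\<Sum>j=k..N. a j) * (r i * y i))"
  proof (rule sum.cong[OF refl])
    fix k assume "k \<in> {..N}"
    then have *: "{j \<in> {..N}. k \<le> j} = {k..N}" "{i \<in> {..N}. i \<le> k} = {..k}" by auto
    show "(\<Sum>j\<in>{j \<in> {..N}. k \<le> j}. a j * (?z k / t k)) = (\<Sum>i\<in>{i \<in> {..N}. i \<le> k}.
        recip_coeff s (k - i) / t k * (\<Sum>j=k..N. a j) * (r i * y i))"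
      unfolding * by (simp add: sum_distrib_left sum_divide_distrib flip: sum_distrib_right)
        (simp add: mult_ac sum_distrib_left sum.swap[of _ "{..k}"])
  qed
  also have "\<dots> = (\<Sum>i\<le>N. \<Sum>k\<in>{k \<in> {..N}. i \<le> k}.
      recip_coeff s (k - i) / t k * (\<Sum>j=k..N. a j) * (r i * y i))"
    by (rule sum.swap_restrict) auto
  also have "\<dots> = (\<Sum>i\<le>N. R_formula r s t (cut N a) i * y i)"
  proof (rule sum.cong[OF refl])
    fix i
    have *: "{k \<in> {..N}. i \<le> k} = {i..N}" by auto
    show "(\<Sum>k\<in>{k \<in> {..N}. i \<le> k}. recip_coeff s (k - i) / t k * (\<Sum>j=k..N. a j) * (r i * y i))
        = R_formula r s t (cut N a) i * y i"
      unfolding * R_formula_cut by (simp add: mult_ac sum_distrib_left)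
  qed
  finally show ?thesis .
qed

section \<open>Convergence of the row series\<close>

lemma w_formula_limit:
  fixes a :: "nat \<Rightarrow> 'a::{real_normed_field, banach}"
  assumes R: "\<And>k. convergent (\<lambda>N. R_formula r s t (cut N a) k)"
  shows "convergent (\<lambda>N. w_formula r s t (cut N a) m k)"
    and "k \<le> Suc m \<Longrightarrow> w r s t a (Suc m) k = R r s t a k - R_formula r s t (cut m a) k"
proof -
  have R': "(\<lambda>N. R_formula r s t (cut N a) k) \<longlonglongrightarrow> R r s t a k"
    using R[of k] by (simp add: R_def convergent_LIMSEQ_iff)
  have w': "(\<lambda>N. w_formula r s t (cut N a) (Suc m) k)
      \<longlonglongrightarrow> R r s t a k - R_formula r s t (cut m a) k" if "k \<le> Suc m" for m
  proof (rule Lim_transform_eventually)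
    show "(\<lambda>N. R_formula r s t (cut N a) k - R_formula r s t (cut m a) k)
        \<longlonglongrightarrow> R r s t a k - R_formula r s t (cut m a) k"
      by (intro tendsto_intros R')
    show "\<forall>\<^sub>F N in sequentially. R_formula r s t (cut N a) k - R_formula r s t (cut m a) k
        = w_formula r s t (cut N a) (Suc m) k"
      using eventually_ge_at_top[of m] by eventually_elim (simp add: w_formula_cut_Suc[OF that])
  qed
  then show "k \<le> Suc m \<Longrightarrow> w r s t a (Suc m) k = R r s t a k - R_formula r s t (cut m a) k"
    by (auto simp: w_def intro: limI)
  show "convergent (\<lambda>N. w_formula r s t (cut N a) m k)"
  proof (cases "k \<le> m")
    case False
    then show ?thesis by (simp add: w_formula_def convergent_const)
  next
    case True
    then show ?thesis
      using w'[of "m - 1"] R by (cases m) (auto simp: convergent_def w_formula_cut_0)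
  qed
qed

text \<open>
  The two sequences differ by an index shift and by the tails \<open>\<Sum>k>N + 1. norm (R r s t a k)\<close>,
  which tend to 0; beyond \<open>N\<close> the truncated row contributes nothing.
\<close>
lemma C4_row_iff:
  fixes a :: "nat \<Rightarrow> 'a::{real_normed_field, banach}"
  assumes R: "\<And>k. convergent (\<lambda>N. R_formula r s t (cut N a) k)"
    and sm: "summable (\<lambda>k. norm (R r s t a k))"
  shows "summable (\<lambda>k. norm (R_formula r s t (cut N a) k - R r s t a k))"
    and "(\<lambda>N. \<Sum>k. norm (R_formula r s t (cut N a) k - R r s t a k)) \<longlonglongrightarrow> 0
      \<longleftrightarrow> (\<lambda>m. \<Sum>k=0..m. norm (w r s t a m k)) \<longlonglongrightarrow> 0"
proof -
  let ?Q = "\<lambda>N. R_formula r s t (cut N a)"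
  have sd: "summable (\<lambda>k. norm (?Q N k - R r s t a k))" for N
  proof (rule summable_comparison_test'[OF sm])
    show "norm (norm (?Q N k - R r s t a k)) \<le> norm (R r s t a k)" if "k \<ge> Suc N" for k
      using that by (simp add: R_formula_cut_eq_0)
  qed
  then show "summable (\<lambda>k. norm (?Q N k - R r s t a k))" .
  have eq: "(\<Sum>k. norm (?Q N k - R r s t a k))
      = (\<Sum>k=0..Suc N. norm (w r s t a (Suc N) k)) + sum_from (N + 2) (\<lambda>k. norm (R r s t a k))" for N
  proof -
    have "(\<Sum>k<N + 2. norm (?Q N k - R r s t a k)) = (\<Sum>k=0..Suc N. norm (w r s t a (Suc N) k))"
      by (rule sum.cong) (auto simp: w_formula_limit(2)[OF R] norm_minus_commute)
    moreover have "sum_from (N + 2) (\<lambda>k. norm (?Q N k - R r s t a k))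
        = sum_from (N + 2) (\<lambda>k. norm (R r s t a k))"
      by (simp add: sum_from_def R_formula_cut_eq_0)
    ultimately show ?thesis using sum_from_split[OF sd, of N "N + 2"] by simp
  qed
  have tail: "(\<lambda>N. sum_from (N + 2) (\<lambda>k. norm (R r s t a k))) \<longlonglongrightarrow> 0"
    by (rule LIMSEQ_ignore_initial_segment[OF sum_from_tendsto_0[OF sm]])
  have "(\<lambda>N. \<Sum>k. norm (?Q N k - R r s t a k)) \<longlonglongrightarrow> 0
      \<longleftrightarrow> (\<lambda>N. \<Sum>k=0..Suc N. norm (w r s t a (Suc N) k)) \<longlonglongrightarrow> 0"
    using tendsto_add[OF _ tail, of _ 0] tendsto_diff[OF _ tail, of _ 0] unfolding eq by force
  also have "\<dots> \<longleftrightarrow> (\<lambda>m. \<Sum>k=0..m. norm (w r s t a m k)) \<longlonglongrightarrow> 0"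
    by (rule filterlim_sequentially_Suc)
  finally show "(\<lambda>N. \<Sum>k. norm (?Q N k - R r s t a k)) \<longlonglongrightarrow> 0
      \<longleftrightarrow> (\<lambda>m. \<Sum>k=0..m. norm (w r s t a m k)) \<longlonglongrightarrow> 0" .
qed

definition admissible_row ::
    "(nat \<Rightarrow> 'a::real_normed_field) \<Rightarrow> (nat \<Rightarrow> 'a) \<Rightarrow> (nat \<Rightarrow> 'a) \<Rightarrow> (nat \<Rightarrow> 'a) \<Rightarrow> bool"
  where "admissible_row r s t a \<longleftrightarrow>
    (\<forall>k. convergent (\<lambda>N. R_formula r s t (cut N a) k))
    \<and> summable (\<lambda>k. norm (R r s t a k))
    \<and> (\<lambda>m. \<Sum>k=0..m. norm (w r s t a m k)) \<longlonglongrightarrow> 0"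

lemma summable_iff_cs:
  "summable (f :: nat \<Rightarrow> 'a::real_normed_field) \<longleftrightarrow> (\<lambda>N. \<Sum>j\<le>N. f j) \<in> cs"
  by (simp add: cs_def summable_iff_convergent')

lemma suminf_R_formula_cut:
  fixes a :: "nat \<Rightarrow> 'a::{real_normed_field, banach}"
  shows "(\<Sum>k. R_formula r s t (cut N a) k * y k) = (\<Sum>j\<le>N. a j * inverse_transform r s t y j)"
  unfolding partial_sum_eq by (rule suminf_finite) (auto simp: R_formula_cut_eq_0)

lemma summable_norm_R_formula_cut:
  fixes a :: "nat \<Rightarrow> 'a::{real_normed_field, banach}"
  shows "summable (\<lambda>k. norm (R_formula r s t (cut N a) k))"
  by (rule summable_finite[of "{..N}"]) (auto simp: R_formula_cut_eq_0)

text \<open>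
  The partial sums of the series are the transforms of \<open>y\<close> under the matrix of truncated rows, so
  that convergence for all bounded \<open>y\<close> is decided by \<open>linf_to_cs_iff\<close>.
\<close>
lemma row_summable_iff:
  fixes a :: "nat \<Rightarrow> 'a::{real_normed_field, banach}"
  shows "(\<forall>y\<in>linf. summable (\<lambda>j. a j * inverse_transform r s t y j)) \<longleftrightarrow> admissible_row r s t a"
proof -
  let ?Q = "\<lambda>N. R_formula r s t (cut N a)"
  have "(\<forall>y\<in>linf. summable (\<lambda>j. a j * inverse_transform r s t y j))
      \<longleftrightarrow> (\<forall>y\<in>linf. (\<lambda>N. \<Sum>k. ?Q N k * y k) \<in> cs)"
    by (simp add: summable_iff_cs suminf_R_formula_cut)
  also have "\<dots> \<longleftrightarrow> (\<forall>k. convergent (\<lambda>N. ?Q N k))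
      \<and> (\<forall>N. summable (\<lambda>k. norm (?Q N k - R r s t a k)))
      \<and> (\<lambda>N. \<Sum>k. norm (?Q N k - R r s t a k)) \<longlonglongrightarrow> 0"
    unfolding R_def by (rule linf_to_cs_iff) (rule summable_norm_R_formula_cut)
  also have "\<dots> \<longleftrightarrow> admissible_row r s t a"
  proof -
    (* The row truncated after 0 has at most one nonzero entry, so R inherits summability. *)
    have sum_R: "summable (\<lambda>k. norm (R r s t a k))" if "summable (\<lambda>k. norm (?Q 0 k - R r s t a k))"
    proof (rule summable_comparison_test'[OF that])
      show "norm (norm (R r s t a k)) \<le> norm (?Q 0 k - R r s t a k)" if "k \<ge> 1" for k
        using that by (simp add: R_formula_cut_eq_0)
    qed
    show ?thesis
    proof (cases "(\<forall>k. convergent (\<lambda>N. ?Q N k)) \<and> summable (\<lambda>k. norm (R r s t a k))")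
      case True
      then have conv: "convergent (\<lambda>N. ?Q N k)" and sm: "summable (\<lambda>k. norm (R r s t a k))" for k
        by blast+
      show ?thesis
        unfolding admissible_row_def using True C4_row_iff[OF conv sm] by simp
    next
      case False
      then have "\<not> ((\<forall>k. convergent (\<lambda>N. ?Q N k)) \<and> (\<forall>N. summable (\<lambda>k. norm (?Q N k - R r s t a k))))"
        using sum_R by auto
      with False show ?thesis unfolding admissible_row_def by argo
    qed
  qed
  finally show ?thesis .
qed

lemma row_suminf:
  fixes a :: "nat \<Rightarrow> 'a::{real_normed_field, banach}"
  assumes adm: "admissible_row r s t a" and y: "y \<in> linf"
  shows "(\<Sum>j. a j * inverse_transform r s t y j) = (\<Sum>k. R r s t a k * y k)"
proof -
  have "(\<lambda>N. \<Sum>k. R_formula r s t (cut N a) k * y k) \<longlonglongrightarrow> (\<Sum>k. R r s t a k * y k)"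
    using adm C4_row_iff[of r s t a]
    by (intro l1_limit_suminf summable_norm_R_formula_cut y) (auto simp: admissible_row_def)
  moreover have "(\<lambda>N. \<Sum>j\<le>N. a j * inverse_transform r s t y j)
      \<longlonglongrightarrow> (\<Sum>j. a j * inverse_transform r s t y j)"
    using adm y by (intro summable_LIMSEQ') (auto simp flip: row_summable_iff)
  ultimately show ?thesis unfolding suminf_R_formula_cut by (rule LIMSEQ_unique[symmetric])
qed

section \<open>Matrix classes\<close>

lemma matrix_class_linf_diff_iff:
  fixes r s t :: "nat \<Rightarrow> 'a::{real_normed_field, banach}"
  assumes "\<And>n. r n \<noteq> 0" "\<And>n. t n \<noteq> 0" "s 0 \<noteq> 0"
  shows "A \<in> matrix_class (linf_diff r s t) V \<longleftrightarrow> (\<forall>n. admissible_row r s t (A n))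
    \<and> (\<forall>y\<in>linf. (\<lambda>n. \<Sum>k. R r s t (A n) k * y k) \<in> V)"
proof -
  have "A \<in> matrix_class (linf_diff r s t) V
      \<longleftrightarrow> (\<forall>n. \<forall>y\<in>linf. summable (\<lambda>k. A n k * inverse_transform r s t y k))
        \<and> (\<forall>y\<in>linf. (\<lambda>n. \<Sum>k. A n k * inverse_transform r s t y k) \<in> V)"
    unfolding matrix_class_def linf_diff_eq_image[of r t s, OF assms] by blast
  also have "\<dots> \<longleftrightarrow> (\<forall>n. admissible_row r s t (A n))
      \<and> (\<forall>y\<in>linf. (\<lambda>n. \<Sum>k. R r s t (A n) k * y k) \<in> V)"
    unfolding row_summable_iff by (auto simp: row_suminf)
  finally show ?thesis .
qed

lemma all_rows_admissible_iff:
  fixes r s t :: "nat \<Rightarrow> 'a::{real_normed_field, banach}"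
  shows "(\<forall>n. admissible_row r s t (A n)) \<longleftrightarrow>
    R_exists r s t A \<and> (\<forall>n. summable (\<lambda>k. norm (R r s t (A n) k))) \<and> C4 r s t A"
  using w_formula_limit(1)[of r s t]
  by (auto simp: admissible_row_def R_exists_def w_exists_def C4_def)

theorem corollary4p1:
  fixes r s t :: "nat \<Rightarrow> 'a::{real_normed_field, banach}"
    and A :: "nat \<Rightarrow> nat \<Rightarrow> 'a"
  assumes "\<And>n. r n \<noteq> 0" and "\<And>n. t n \<noteq> 0" and "s 0 \<noteq> 0"
  shows "(A \<in> matrix_class (linf_diff r s t) c0 \<longleftrightarrow> C3 r s t A \<and> C4 r s t A)
    \<and> (A \<in> matrix_class (linf_diff r s t) cs
         \<longleftrightarrow> C1 r s t A \<and> C2 r s t A \<and> C4 r s t A \<and> C5 r s t A)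
    \<and> (A \<in> matrix_class (linf_diff r s t) linf \<longleftrightarrow> C1 r s t A \<and> C4 r s t A)"
proof (intro conjI)
  note iff = matrix_class_linf_diff_iff[of r t s, OF assms, unfolded all_rows_admissible_iff]
  show "A \<in> matrix_class (linf_diff r s t) c0 \<longleftrightarrow> C3 r s t A \<and> C4 r s t A"
    unfolding iff C3_def using linf_to_c0_iff[of "\<lambda>n. R r s t (A n)"] by blast
  show linf: "A \<in> matrix_class (linf_diff r s t) linf \<longleftrightarrow> C1 r s t A \<and> C4 r s t A"
    unfolding iff C1_def using linf_to_linf_iff[of "\<lambda>n. R r s t (A n)"]
    by (cases "\<forall>n. summable (\<lambda>k. norm (R r s t (A n) k))") auto
  (* C1 is the condition for bounded images, and convergent sequences are bounded. *)
  have "(cs :: (nat \<Rightarrow> 'a) set) \<subseteq> linf"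
    by (auto simp: cs_def linf_def intro: convergent_imp_Bseq)
  then have C1: "A \<in> matrix_class (linf_diff r s t) cs \<Longrightarrow> C1 r s t A"
    using linf by (auto simp: matrix_class_def)
  show "A \<in> matrix_class (linf_diff r s t) cs
      \<longleftrightarrow> C1 r s t A \<and> C2 r s t A \<and> C4 r s t A \<and> C5 r s t A"
  proof (cases "\<forall>n. summable (\<lambda>k. norm (R r s t (A n) k))")
    case True
    then have sm: "summable (\<lambda>k. norm (R r s t (A n) k))" for n by blast
    show ?thesis
      using C1 True linf_to_cs_iff[of "\<lambda>n. R r s t (A n)", OF sm]
      unfolding iff C1_def C2_def C5_def by argo
  next
    case False
    then show ?thesis unfolding iff C1_def by argo
  qed
qed

end
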